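(* Let $\Omega\subset\mathbb{R}^d$ be a domain, let $f,\phi\in L^2(\Omega)$, and let $A\in\mathcal{L}(L^2(\Omega))$ be self-adjoint and coercive. Consider the problem $$\min_{y\in L^2(\Omega)}\ \tfrac12(y,Ay)_{L^2(\Omega)}-(f,y)_{L^2(\Omega)}\quad\text{subject to}\quad y\ge\phi\ \text{a.e.}$$ Let $(y_k,\lambda_k)$ be the primal and dual iterates of the HIK algorithm for this problem, with active and inactive sets $\mathfrak{A}_k,\mathfrak{I}_k$, updates $\delta y_k=y_{k+1}-y_k$, and half steps $y_{k+1/2}$; and let $u_k$ be the iterates of the BM algorithm for this problem, with active and inactive sets $\mathcal{A}_k,\mathcal{I}_k$ and updates $\delta u_k$ (all as defined in the context). Suppose that for some $k\geq 0$ $$\mathcal{A}_k=\mathfrak{A}_k,\qquad \mathcal{I}_k=\mathfrak{I}_k,\qquad E^*_{\mathfrak{I}_k}y_k=E^*_{\mathcal{I}_k}u_k.$$ Then the following three equalities hold: 1. $y_{k+1/2}=u_k$; 2. $E^*_{\mathfrak{I}_k}\delta y_k=E^*_{\mathcal{I}_k}\delta u_k$; 3. $y_{k+3/2}=u_{k+1}$.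
   Context: All sets are understood up to null sets and all pointwise relations hold almost everywhere. For measurable $S\subset\Omega$, $E_S:L^2(S)\to L^2(\Omega)$ is the extension-by-zero operator and its adjoint $E_S^*:L^2(\Omega)\to L^2(S)$ is the restriction operator. Coercive means there is $c>0$ with $(y,Ay)_{L^2(\Omega)}\ge c\|y\|^2_{L^2(\Omega)}$ for all $y\in L^2(\Omega)$. **HIK (primal-dual active set) algorithm.** Start from some $(y_0,\lambda_0)\in L^2(\Omega)\times L^2(\Omega)$. Given $(y_k,\lambda_k)$, set $$\mathfrak{A}_k=\{x:\lambda_k-(y_k-\phi)>0\},\qquad \mathfrak{I}_k=\{x:\lambda_k-(y_k-\phi)\le0\},$$ and let $(y_{k+1},\lambda_{k+1})\in L^2(\Omega)\times L^2(\Omega)$ be the unique solution of $$Ay_{k+1}-\lambda_{k+1}=f,\qquad E_{\mathfrak{A}_k}^*y_{k+1}=E_{\mathfrak{A}_k}^*\phi,\qquad E_{\mathfrak{I}_k}^*\lambda_{k+1}=0.$$ The update is $\delta y_k=y_{k+1}-y_k$. For every $k$, the half step $y_{k+1/2}\in L^2(\Omega)$ updates the active set first: it is defined by $E^*_{\mathfrak{A}_k}y_{k+1/2}=E^*_{\mathfrak{A}_k}y_{k+1}$ and $E^*_{\mathfrak{I}_k}y_{k+1/2}=E^*_{\mathfrak{I}_k}y_k$. Thus $y_{k+3/2}$ is the half step of iteration $k+1$, i.e. $E^*_{\mathfrak{A}_{k+1}}y_{k+3/2}=E^*_{\mathfrak{A}_{k+1}}y_{k+2}$ and $E^*_{\mathfrak{I}_{k+1}}y_{k+3/2}=E^*_{\mathfrak{I}_{k+1}}y_{k+1}$.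 **BM (active-set reduced space) algorithm.** Start from a feasible $u_0\in L^2(\Omega)$, i.e. $u_0\ge\phi$. Given $u_k$, put $F(u_k)=Au_k-f$ (the $L^2$-representation of the Fréchet derivative of the objective at $u_k$) and $$\mathcal{A}_k=\{x:u_k=\phi\text{ and }F(u_k)>0\},\qquad \mathcal{I}_k=\{x:u_k>\phi\text{ or }F(u_k)\le0\}.$$ Let $\delta u_k\in L^2(\Omega)$ be the solution of $$E_{\mathcal{I}_k}^*AE_{\mathcal{I}_k}E_{\mathcal{I}_k}^*\delta u_k=-E_{\mathcal{I}_k}^*(Au_k-f),\qquad E_{\mathcal{A}_k}^*\delta u_k=0,$$ and set $u_{k+1}=\pi(u_k+\delta u_k)$, where $\pi$ is the $L^2(\Omega)$-projection onto $K=\{v\in L^2(\Omega):v\ge\phi\}$, i.e. $\pi(u)\in K$ and $\|u-\pi(u)\|_{L^2(\Omega)}\le\|u-v\|_{L^2(\Omega)}$ for all $v\in K$. *)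

theory Defs
  imports "HOL-Analysis.Analysis"
begin

text \<open>
  Elements of \<open>L\<^sup>2(S)\<close> are handled through representatives: functions on the whole Euclidean space
  whose values outside \<open>S\<close> are irrelevant. Equality in \<open>L\<^sup>2(S)\<close> is \<open>ae_eq S\<close>, and
  equality of subsets of \<open>\<Omega>\<close> up to null sets is \<open>ae_set_eq \<Omega>\<close>.
\<close>

definition L2 :: "'a::euclidean_space set \<Rightarrow> ('a \<Rightarrow> real) set" where
  "L2 S = {v. v \<in> borel_measurable (lebesgue_on S) \<and> integrable (lebesgue_on S) (\<lambda>x. (v x)\<^sup>2)}"

definition ae_eq :: "'a::euclidean_space set \<Rightarrow> ('a \<Rightarrow> real) \<Rightarrow> ('a \<Rightarrow> real) \<Rightarrow> bool" where
  "ae_eq S v w \<longleftrightarrow> (AE x in lebesgue_on S. v x = w x)"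

definition ae_set_eq :: "'a::euclidean_space set \<Rightarrow> 'a set \<Rightarrow> 'a set \<Rightarrow> bool" where
  "ae_set_eq \<Omega> S T \<longleftrightarrow> (AE x in lebesgue_on \<Omega>. x \<in> S \<longleftrightarrow> x \<in> T)"

definition L2_inner :: "'a::euclidean_space set \<Rightarrow> ('a \<Rightarrow> real) \<Rightarrow> ('a \<Rightarrow> real) \<Rightarrow> real" where
  "L2_inner S v w = (LINT x|lebesgue_on S. v x * w x)"

definition L2_norm :: "'a::euclidean_space set \<Rightarrow> ('a \<Rightarrow> real) \<Rightarrow> real" where
  "L2_norm S v = sqrt (L2_inner S v v)"

definition ext0 :: "'a::euclidean_space set \<Rightarrow> ('a \<Rightarrow> real) \<Rightarrow> ('a \<Rightarrow> real)" where
  "ext0 S v = (\<lambda>x. if x \<in> S then v x else 0)"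

text \<open>
  The adjoint of \<open>ext0 S\<close> is the restriction \<open>restrict v S\<close>. It is \<open>undefined\<close> outside \<open>S\<close>
  and therefore is only ever compared by \<open>ae_eq S\<close> or extended by \<open>ext0 S\<close>.
\<close>

text \<open>
  Bounded linear operators on \<open>L\<^sup>2(\<Omega>)\<close>; the second conjunct says that the operator is well defined on
  classes of functions that agree almost everywhere.
\<close>

definition L2_operator ::
    "'a::euclidean_space set \<Rightarrow> (('a \<Rightarrow> real) \<Rightarrow> ('a \<Rightarrow> real)) \<Rightarrow> bool" where
  "L2_operator \<Omega> A \<longleftrightarrow>
     (\<forall>v\<in>L2 \<Omega>. A v \<in> L2 \<Omega>) \<and>
     (\<forall>v\<in>L2 \<Omega>. \<forall>w\<in>L2 \<Omega>. ae_eq \<Omega> v w \<longrightarrow> ae_eq \<Omega> (A v) (A w)) \<and>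
     (\<forall>v\<in>L2 \<Omega>. \<forall>w\<in>L2 \<Omega>. ae_eq \<Omega> (A (\<lambda>x. v x + w x)) (\<lambda>x. A v x + A w x)) \<and>
     (\<forall>c. \<forall>v\<in>L2 \<Omega>. ae_eq \<Omega> (A (\<lambda>x. c * v x)) (\<lambda>x. c * A v x)) \<and>
     (\<exists>C. \<forall>v\<in>L2 \<Omega>. L2_norm \<Omega> (A v) \<le> C * L2_norm \<Omega> v)"

definition L2_self_adjoint ::
    "'a::euclidean_space set \<Rightarrow> (('a \<Rightarrow> real) \<Rightarrow> ('a \<Rightarrow> real)) \<Rightarrow> bool" where
  "L2_self_adjoint \<Omega> A \<longleftrightarrow> (\<forall>v\<in>L2 \<Omega>. \<forall>w\<in>L2 \<Omega>. L2_inner \<Omega> (A v) w = L2_inner \<Omega> v (A w))"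

definition L2_coercive ::
    "'a::euclidean_space set \<Rightarrow> (('a \<Rightarrow> real) \<Rightarrow> ('a \<Rightarrow> real)) \<Rightarrow> bool" where
  "L2_coercive \<Omega> A \<longleftrightarrow> (\<exists>c>0. \<forall>v\<in>L2 \<Omega>. L2_inner \<Omega> v (A v) \<ge> c * (L2_norm \<Omega> v)\<^sup>2)"


definition objective ::
    "'a::euclidean_space set \<Rightarrow> (('a \<Rightarrow> real) \<Rightarrow> ('a \<Rightarrow> real)) \<Rightarrow> ('a \<Rightarrow> real) \<Rightarrow> ('a \<Rightarrow> real) \<Rightarrow> real"
  where "objective \<Omega> A f v = 1/2 * L2_inner \<Omega> v (A v) - L2_inner \<Omega> f v"

definition feasible :: "'a::euclidean_space set \<Rightarrow> ('a \<Rightarrow> real) \<Rightarrow> ('a \<Rightarrow> real) set" where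
  "feasible \<Omega> \<phi> = {v \<in> L2 \<Omega>. AE x in lebesgue_on \<Omega>. v x \<ge> \<phi> x}"

definition obj_grad ::
    "(('a::euclidean_space \<Rightarrow> real) \<Rightarrow> ('a \<Rightarrow> real)) \<Rightarrow> ('a \<Rightarrow> real) \<Rightarrow> ('a \<Rightarrow> real) \<Rightarrow> ('a \<Rightarrow> real)" where
  "obj_grad A f u = (\<lambda>x. A u x - f x)"

lemma L2_mult_integrable:
  assumes "v \<in> L2 S" "w \<in> L2 S"
  shows "integrable (lebesgue_on S) (\<lambda>x. v x * w x)"
proof (rule Bochner_Integration.integrable_bound)
  show "integrable (lebesgue_on S) (\<lambda>x. (v x)\<^sup>2 + (w x)\<^sup>2)"
    using assms by (auto simp: L2_def)
  show "(\<lambda>x. v x * w x) \<in> borel_measurable (lebesgue_on S)"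
    using assms by (auto simp: L2_def)
  have "\<bar>a * b\<bar> \<le> a\<^sup>2 + b\<^sup>2" for a b :: real
  proof -
    have "2 * \<bar>a * b\<bar> \<le> a\<^sup>2 + b\<^sup>2"
      using sum_squares_bound[of "\<bar>a\<bar>" "\<bar>b\<bar>"] by (simp add: abs_mult mult.assoc)
    then show ?thesis using abs_ge_zero[of "a * b"] by linarith
  qed
  then show "AE x in lebesgue_on S. norm (v x * w x) \<le> norm ((v x)\<^sup>2 + (w x)\<^sup>2)"
    by simp
qed

text \<open>
  The remainder below is \<open>O(\<parallel>v\<parallel>\<^sup>2)\<close>, so \<open>obj_grad\<close> represents the derivative of the objective.
\<close>

lemma objective_expansion:
  assumes A: "L2_operator \<Omega> A" "L2_self_adjoint \<Omega> A"
    and L: "f \<in> L2 \<Omega>" "u \<in> L2 \<Omega>" "v \<in> L2 \<Omega>"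
  shows "objective \<Omega> A f (\<lambda>x. u x + v x) =
    objective \<Omega> A f u + L2_inner \<Omega> (obj_grad A f u) v + 1/2 * L2_inner \<Omega> v (A v)"
proof -
  have Au: "A u \<in> L2 \<Omega>" and Av: "A v \<in> L2 \<Omega>"
    and add: "AE x in lebesgue_on \<Omega>. A (\<lambda>x. u x + v x) x = A u x + A v x"
    using A L unfolding L2_operator_def ae_eq_def by blast+
  have "(\<lambda>x. u x + v x) \<in> L2 \<Omega>"
  proof -
    have "integrable (lebesgue_on \<Omega>) (\<lambda>x. (u x)\<^sup>2 + (v x)\<^sup>2 + 2 * (u x * v x))"
      using L L2_mult_integrable[of u \<Omega> v] by (simp add: L2_def)
    then show ?thesis
      using L by (simp add: L2_def power2_sum mult.assoc borel_measurable_add)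
  qed
  then have m: "A (\<lambda>x. u x + v x) \<in> borel_measurable (lebesgue_on \<Omega>)"
    using A unfolding L2_operator_def L2_def by blast
  note i = L2_mult_integrable
  have "L2_inner \<Omega> (\<lambda>x. u x + v x) (A (\<lambda>x. u x + v x)) =
      (LINT x|lebesgue_on \<Omega>. u x * A u x + v x * A u x + (u x * A v x + v x * A v x))"
    unfolding L2_inner_def
  proof (rule integral_cong_AE)
    show "AE x in lebesgue_on \<Omega>. (u x + v x) * A (\<lambda>x. u x + v x) x =
        u x * A u x + v x * A u x + (u x * A v x + v x * A v x)"
      using add by eventually_elim (simp add: distrib_left distrib_right)
  qed (use m L Au Av in \<open>simp_all add: L2_def borel_measurable_add borel_measurable_times\<close>)
  also have "\<dots> = L2_inner \<Omega> u (A u) + L2_inner \<Omega> v (A u) + (L2_inner \<Omega> u (A v) + L2_inner \<Omega> v (A v))"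
    unfolding L2_inner_def using L Au Av by (simp add: i)
  also have "L2_inner \<Omega> u (A v) = L2_inner \<Omega> v (A u)"
  proof -
    have "L2_inner \<Omega> u (A v) = L2_inner \<Omega> (A u) v"
      using A L unfolding L2_self_adjoint_def by metis
    then show ?thesis by (simp add: L2_inner_def mult.commute)
  qed
  finally have 1: "L2_inner \<Omega> (\<lambda>x. u x + v x) (A (\<lambda>x. u x + v x)) =
      L2_inner \<Omega> u (A u) + 2 * L2_inner \<Omega> v (A u) + L2_inner \<Omega> v (A v)" by simp
  have 2: "L2_inner \<Omega> f (\<lambda>x. u x + v x) = L2_inner \<Omega> f u + L2_inner \<Omega> f v"
    unfolding L2_inner_def using L by (simp add: i distrib_left)
  have 3: "L2_inner \<Omega> (obj_grad A f u) v = L2_inner \<Omega> (A u) v - L2_inner \<Omega> f v"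
    unfolding L2_inner_def obj_grad_def using L Au by (simp add: i left_diff_distrib)
  have 4: "L2_inner \<Omega> (A u) v = L2_inner \<Omega> v (A u)"
    by (simp add: L2_inner_def mult.commute)
  show ?thesis
    unfolding objective_def 1 2 3 4 by simp
qed


definition hik_active :: "'a::euclidean_space set \<Rightarrow> ('a \<Rightarrow> real) \<Rightarrow> ('a \<Rightarrow> real) \<Rightarrow> ('a \<Rightarrow> real) \<Rightarrow> 'a set"
  where "hik_active \<Omega> \<phi> y l = {x\<in>\<Omega>. l x - (y x - \<phi> x) > 0}"

definition hik_inactive :: "'a::euclidean_space set \<Rightarrow> ('a \<Rightarrow> real) \<Rightarrow> ('a \<Rightarrow> real) \<Rightarrow> ('a \<Rightarrow> real) \<Rightarrow> 'a set"
  where "hik_inactive \<Omega> \<phi> y l = {x\<in>\<Omega>. l x - (y x - \<phi> x) \<le> 0}"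

text \<open>
  The system defining the next iterate has a unique solution up to null sets when the operator is
  bounded, linear and coercive, so it suffices to require that the next iterate solves it. The same
  applies to the BM update.
\<close>

definition hik_iterates ::
    "'a::euclidean_space set \<Rightarrow> (('a \<Rightarrow> real) \<Rightarrow> ('a \<Rightarrow> real)) \<Rightarrow> ('a \<Rightarrow> real) \<Rightarrow> ('a \<Rightarrow> real) \<Rightarrow>
     (nat \<Rightarrow> 'a \<Rightarrow> real) \<Rightarrow> (nat \<Rightarrow> 'a \<Rightarrow> real) \<Rightarrow> bool" where
  "hik_iterates \<Omega> A f \<phi> y l \<longleftrightarrow>
     (\<forall>k. y k \<in> L2 \<Omega> \<and> l k \<in> L2 \<Omega>) \<and>
     (\<forall>k. let act = hik_active \<Omega> \<phi> (y k) (l k); ina = hik_inactive \<Omega> \<phi> (y k) (l k) in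
        ae_eq \<Omega> (\<lambda>x. A (y (Suc k)) x - l (Suc k) x) f \<and>
        ae_eq act (restrict (y (Suc k)) act) (restrict \<phi> act) \<and>
        ae_eq ina (restrict (l (Suc k)) ina) (\<lambda>x. 0))"

text \<open>\<open>yh k\<close> stands for the half step with index \<open>k + 1/2\<close>.\<close>

definition hik_half_steps ::
    "'a::euclidean_space set \<Rightarrow> ('a \<Rightarrow> real) \<Rightarrow>
     (nat \<Rightarrow> 'a \<Rightarrow> real) \<Rightarrow> (nat \<Rightarrow> 'a \<Rightarrow> real) \<Rightarrow> (nat \<Rightarrow> 'a \<Rightarrow> real) \<Rightarrow> bool" where
  "hik_half_steps \<Omega> \<phi> y l yh \<longleftrightarrow>
     (\<forall>k. yh k \<in> L2 \<Omega>) \<and>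
     (\<forall>k. let act = hik_active \<Omega> \<phi> (y k) (l k); ina = hik_inactive \<Omega> \<phi> (y k) (l k) in
        ae_eq act (restrict (yh k) act) (restrict (y (Suc k)) act) \<and>
        ae_eq ina (restrict (yh k) ina) (restrict (y k) ina))"


definition bm_active ::
    "'a::euclidean_space set \<Rightarrow> (('a \<Rightarrow> real) \<Rightarrow> ('a \<Rightarrow> real)) \<Rightarrow> ('a \<Rightarrow> real) \<Rightarrow> ('a \<Rightarrow> real) \<Rightarrow>
     ('a \<Rightarrow> real) \<Rightarrow> 'a set" where
  "bm_active \<Omega> A f \<phi> u = {x\<in>\<Omega>. u x = \<phi> x \<and> obj_grad A f u x > 0}"

definition bm_inactive ::
    "'a::euclidean_space set \<Rightarrow> (('a \<Rightarrow> real) \<Rightarrow> ('a \<Rightarrow> real)) \<Rightarrow> ('a \<Rightarrow> real) \<Rightarrow> ('a \<Rightarrow> real) \<Rightarrow>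
     ('a \<Rightarrow> real) \<Rightarrow> 'a set" where
  "bm_inactive \<Omega> A f \<phi> u = {x\<in>\<Omega>. u x > \<phi> x \<or> obj_grad A f u x \<le> 0}"

definition is_L2_projection ::
    "'a::euclidean_space set \<Rightarrow> ('a \<Rightarrow> real) set \<Rightarrow> ('a \<Rightarrow> real) \<Rightarrow> ('a \<Rightarrow> real) \<Rightarrow> bool" where
  "is_L2_projection \<Omega> K u p \<longleftrightarrow>
     p \<in> K \<and> (\<forall>v\<in>K. L2_norm \<Omega> (\<lambda>x. u x - p x) \<le> L2_norm \<Omega> (\<lambda>x. u x - v x))"

definition bm_iterates ::
    "'a::euclidean_space set \<Rightarrow> (('a \<Rightarrow> real) \<Rightarrow> ('a \<Rightarrow> real)) \<Rightarrow> ('a \<Rightarrow> real) \<Rightarrow> ('a \<Rightarrow> real) \<Rightarrow>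
     (nat \<Rightarrow> 'a \<Rightarrow> real) \<Rightarrow> (nat \<Rightarrow> 'a \<Rightarrow> real) \<Rightarrow> bool" where
  "bm_iterates \<Omega> A f \<phi> u du \<longleftrightarrow>
     u 0 \<in> feasible \<Omega> \<phi> \<and>
     (\<forall>k. du k \<in> L2 \<Omega>) \<and>
     (\<forall>k. let act = bm_active \<Omega> A f \<phi> (u k); ina = bm_inactive \<Omega> A f \<phi> (u k) in
        ae_eq ina (restrict (A (ext0 ina (restrict (du k) ina))) ina)
                  (\<lambda>x. - restrict (obj_grad A f (u k)) ina x) \<and>
        ae_eq act (restrict (du k) act) (\<lambda>x. 0) \<and>
        is_L2_projection \<Omega> (feasible \<Omega> \<phi>) (\<lambda>x. u k x + du k x) (u (Suc k)))"

end

(*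
  Where HIK and BM agree on the active set and on the inactive values, the full HIK step is the
  unprojected BM step: y_{k+1} - (u_k + du_k) vanishes on the active set, and its image under A
  vanishes on the inactive set, so it is zero by coercivity. The L^2-projection is the pointwise
  maximum with phi, and complementarity of (y_{k+1}, lambda_{k+1}) makes the half step after
  y_{k+1} that same pointwise maximum.
*)
theory Submission
  imports Defs
begin

lemma L2_add:
  assumes "v \<in> L2 S" "w \<in> L2 S"
  shows "(\<lambda>x. v x + w x) \<in> L2 S"
proof -
  have "integrable (lebesgue_on S) (\<lambda>x. (v x)\<^sup>2 + (w x)\<^sup>2 + 2 * (v x * w x))"
    using assms L2_mult_integrable[of v S w] by (simp add: L2_def)
  then show ?thesis
    using assms by (simp add: L2_def power2_sum mult.assoc borel_measurable_add)
qed

lemma L2_scale: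
  assumes "v \<in> L2 S"
  shows "(\<lambda>x. c * v x) \<in> L2 S"
  using assms by (auto simp: L2_def power_mult_distrib)

lemma L2_diff:
  assumes "v \<in> L2 S" "w \<in> L2 S"
  shows "(\<lambda>x. v x - w x) \<in> L2 S"
  using L2_add[OF assms(1) L2_scale[OF assms(2), of "-1"]] by simp

text \<open>Serves two truncations, the positive part and the extension by zero: their squares are
  bounded by the square of the function that is truncated.\<close>

lemma L2_dominated:
  assumes g: "g \<in> L2 S" and m: "v \<in> borel_measurable (lebesgue_on S)"
    and le: "\<And>x. \<bar>v x\<bar> \<le> \<bar>g x\<bar>"
  shows "v \<in> L2 S"
proof -
  have "integrable (lebesgue_on S) (\<lambda>x. (v x)\<^sup>2)"
  proof (rule Bochner_Integration.integrable_bound)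
    show "integrable (lebesgue_on S) (\<lambda>x. (g x)\<^sup>2)" using g by (simp add: L2_def)
    show "AE x in lebesgue_on S. norm ((v x)\<^sup>2) \<le> norm ((g x)\<^sup>2)"
      using le by (simp add: abs_le_square_iff)
  qed (use m in simp)
  with m show ?thesis by (simp add: L2_def)
qed

lemma L2_max:
  assumes "v \<in> L2 S" "w \<in> L2 S"
  shows "(\<lambda>x. max (v x) (w x)) \<in> L2 S"
proof -
  have [measurable]: "v \<in> borel_measurable (lebesgue_on S)" "w \<in> borel_measurable (lebesgue_on S)"
    using assms by (auto simp: L2_def)
  \<comment> \<open>The maximum is \<open>v\<close> plus the positive part of \<open>w - v\<close>,
    and the latter is dominated by \<open>w - v\<close>.\<close>
  have "(\<lambda>x. max 0 (w x - v x)) \<in> L2 S"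
    by (rule L2_dominated[OF L2_diff[OF assms(2,1)]]) auto
  from L2_add[OF assms(1) this] show ?thesis
    by (simp add: max_def if_distrib cong: if_cong)
qed

lemma L2_ext0:
  assumes "v \<in> L2 \<Omega>" and S: "S \<in> sets (lebesgue_on \<Omega>)"
  shows "ext0 S v \<in> L2 \<Omega>"
proof (rule L2_dominated[OF assms(1)])
  show "ext0 S v \<in> borel_measurable (lebesgue_on \<Omega>)"
    unfolding ext0_def
    by (rule measurable_If_set) (use assms S sets.Int_space_eq1[OF S] in \<open>auto simp: L2_def\<close>)
qed (simp add: ext0_def)

lemma L2_norm_squared: "(L2_norm \<Omega> v)\<^sup>2 = (LINT x|lebesgue_on \<Omega>. (v x)\<^sup>2)"
  by (simp add: L2_norm_def L2_inner_def power2_eq_square)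

lemma L2_norm_eq_0_iff:
  assumes "v \<in> L2 \<Omega>"
  shows "L2_norm \<Omega> v = 0 \<longleftrightarrow> ae_eq \<Omega> v (\<lambda>x. 0)"
proof -
  have "L2_norm \<Omega> v = 0 \<longleftrightarrow> (LINT x|lebesgue_on \<Omega>. (v x)\<^sup>2) = 0"
    by (metis L2_norm_squared power_eq_0_iff zero_neq_numeral power_zero_numeral)
  also have "\<dots> \<longleftrightarrow> ae_eq \<Omega> v (\<lambda>x. 0)"
    using assms by (subst integral_nonneg_eq_0_iff_AE) (auto simp: L2_def ae_eq_def)
  finally show ?thesis .
qed

text \<open>Moves equalities on the various active and inactive sets to the one measure on
  \<open>\<Omega>\<close>, where they can be combined pointwise. This is why those sets are shown to
  be measurable.\<close>

lemma ae_eq_subset_iff: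
  assumes "\<Omega> \<in> sets lebesgue" "S \<in> sets (lebesgue_on \<Omega>)"
  shows "ae_eq S v w \<longleftrightarrow> (AE x in lebesgue_on \<Omega>. x \<in> S \<longrightarrow> v x = w x)"
proof -
  have "S \<in> sets lebesgue" "S \<subseteq> \<Omega>"
    using assms by (auto simp: sets_restrict_space_iff)
  then show ?thesis
    using assms(1) unfolding ae_eq_def
    by (simp add: AE_restrict_space_iff) (auto intro!: AE_cong)
qed

lemma L2_operator_diff:
  assumes "L2_operator \<Omega> A" "v \<in> L2 \<Omega>" "w \<in> L2 \<Omega>"
  shows "ae_eq \<Omega> (A (\<lambda>x. v x - w x)) (\<lambda>x. A v x - A w x)"
proof -
  \<comment> \<open>Linearity is given as additivity and homogeneity up to null sets, so the
    difference is treated as a sum with the multiple by -1.\<close>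
  have "ae_eq \<Omega> (A (\<lambda>x. c * w x)) (\<lambda>x. c * A w x)" for c
    using assms unfolding L2_operator_def by blast
  from this[of "-1"] have "ae_eq \<Omega> (A (\<lambda>x. - w x)) (\<lambda>x. - A w x)"
    by simp
  moreover have "(\<lambda>x. - w x) \<in> L2 \<Omega>"
    using L2_scale[OF assms(3), of "-1"] by simp
  with assms(1,2) have "ae_eq \<Omega> (A (\<lambda>x. v x + - w x)) (\<lambda>x. A v x + A (\<lambda>x. - w x) x)"
    unfolding L2_operator_def by (simp only:)
  ultimately show ?thesis
    unfolding ae_eq_def by eventually_elim simp
qed

text \<open>The product of \<open>v\<close> and \<open>A v\<close> vanishes almost everywhere, so
  their inner product is 0 and coercivity leaves no room for a positive norm.\<close>

lemma coercive_eq_0I: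
  assumes "L2_coercive \<Omega> A" "v \<in> L2 \<Omega>"
    and z: "AE x in lebesgue_on \<Omega>. v x = 0 \<or> A v x = 0"
  shows "ae_eq \<Omega> v (\<lambda>x. 0)"
proof -
  obtain c where c: "c > 0" "c * (L2_norm \<Omega> v)\<^sup>2 \<le> L2_inner \<Omega> v (A v)"
    using assms(1,2) unfolding L2_coercive_def by blast
  have "AE x in lebesgue_on \<Omega>. v x * A v x = 0"
    using z by eventually_elim auto
  then have "L2_inner \<Omega> v (A v) = 0"
    unfolding L2_inner_def by (rule integral_eq_zero_AE)
  with c have "(L2_norm \<Omega> v)\<^sup>2 \<le> 0"
    by (simp add: mult_le_0_iff)
  then show ?thesis
    using L2_norm_eq_0_iff[OF assms(2)] by simp
qed

text \<open>At almost every point the maximum is at least as close to \<open>w\<close> as any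
  feasible value. A minimiser of the integrated squared distance must therefore attain this least
  distance almost everywhere.\<close>

lemma L2_projection_feasible_eq_max:
  assumes "w \<in> L2 \<Omega>" "\<phi> \<in> L2 \<Omega>"
    and proj: "is_L2_projection \<Omega> (feasible \<Omega> \<phi>) w p"
  shows "ae_eq \<Omega> p (\<lambda>x. max (w x) (\<phi> x))"
proof -
  define q where "q = (\<lambda>x. max (w x) (\<phi> x))"
  have q: "q \<in> L2 \<Omega>" unfolding q_def by (rule L2_max[OF assms(1,2)])
  then have "q \<in> feasible \<Omega> \<phi>" by (simp add: feasible_def q_def)
  with proj have p: "p \<in> L2 \<Omega>" and ge: "AE x in lebesgue_on \<Omega>. \<phi> x \<le> p x"
    and le: "L2_norm \<Omega> (\<lambda>x. w x - p x) \<le> L2_norm \<Omega> (\<lambda>x. w x - q x)"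
    by (auto simp: is_L2_projection_def feasible_def)
  \<comment> \<open>The pointwise excess of \<open>p\<close> over \<open>q\<close> in squared
    distance: nonnegative because \<open>p\<close> is feasible, with integral at most 0 because
    \<open>p\<close> is minimal, hence null.\<close>
  define g where "g = (\<lambda>x. (w x - p x)\<^sup>2 - (w x - q x)\<^sup>2)"
  have ip: "integrable (lebesgue_on \<Omega>) (\<lambda>x. (w x - p x)\<^sup>2)"
    and iq: "integrable (lebesgue_on \<Omega>) (\<lambda>x. (w x - q x)\<^sup>2)"
    using L2_diff[OF assms(1) p] L2_diff[OF assms(1) q] by (auto simp: L2_def)
  have g0: "AE x in lebesgue_on \<Omega>. 0 \<le> g x"
    using ge by eventually_elim (auto simp: g_def q_def max_def abs_le_square_iff[symmetric])
  have "(L2_norm \<Omega> (\<lambda>x. w x - p x))\<^sup>2 \<le> (L2_norm \<Omega> (\<lambda>x. w x - q x))\<^sup>2"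
    using le by (intro power_mono) (auto simp: L2_norm_def L2_inner_def)
  then have "(LINT x|lebesgue_on \<Omega>. g x) \<le> 0"
    using ip iq by (simp add: L2_norm_squared g_def)
  moreover have "0 \<le> (LINT x|lebesgue_on \<Omega>. g x)"
    using g0 by (rule integral_nonneg_AE)
  ultimately have "(LINT x|lebesgue_on \<Omega>. g x) = 0" by simp
  then have "AE x in lebesgue_on \<Omega>. g x = 0"
    using ip iq g0 by (subst (asm) integral_nonneg_eq_0_iff_AE) (auto simp: g_def)
  with ge have "AE x in lebesgue_on \<Omega>. p x = q x"
  proof eventually_elim
    case (elim x)
    \<comment> \<open>Equal distances allow \<open>p\<close> to be \<open>q\<close> or its
      reflection in \<open>w\<close>. If the two differ, then \<open>q\<close> is \<phi> and lies
      above \<open>w\<close>, so the reflection falls below \<phi> and is infeasible.\<close>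
    then have "\<bar>w x - p x\<bar> = \<bar>w x - q x\<bar>"
      by (simp add: g_def power2_eq_iff abs_eq_iff)
    with elim(1) show ?case by (auto simp: q_def max_def split: if_splits)
  qed
  then show ?thesis by (simp add: ae_eq_def q_def)
qed

lemma hik_active_sets:
  assumes "\<phi> \<in> L2 \<Omega>" "y \<in> L2 \<Omega>" "l \<in> L2 \<Omega>"
  shows "hik_active \<Omega> \<phi> y l \<in> sets (lebesgue_on \<Omega>)"
    and "hik_inactive \<Omega> \<phi> y l \<in> sets (lebesgue_on \<Omega>)"
proof -
  have [measurable]: "\<phi> \<in> borel_measurable (lebesgue_on \<Omega>)" "y \<in> borel_measurable (lebesgue_on \<Omega>)"
    "l \<in> borel_measurable (lebesgue_on \<Omega>)"
    using assms by (auto simp: L2_def)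
  have "{x \<in> space (lebesgue_on \<Omega>). l x - (y x - \<phi> x) > 0} \<in> sets (lebesgue_on \<Omega>)"
    and "{x \<in> space (lebesgue_on \<Omega>). l x - (y x - \<phi> x) \<le> 0} \<in> sets (lebesgue_on \<Omega>)"
    by measurable
  then show "hik_active \<Omega> \<phi> y l \<in> sets (lebesgue_on \<Omega>)"
    and "hik_inactive \<Omega> \<phi> y l \<in> sets (lebesgue_on \<Omega>)"
    unfolding hik_active_def hik_inactive_def by auto
qed

lemma bm_active_sets:
  assumes "\<phi> \<in> L2 \<Omega>" "f \<in> L2 \<Omega>" "u \<in> L2 \<Omega>" "L2_operator \<Omega> A"
  shows "bm_active \<Omega> A f \<phi> u \<in> sets (lebesgue_on \<Omega>)"
    and "bm_inactive \<Omega> A f \<phi> u \<in> sets (lebesgue_on \<Omega>)"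
proof -
  have [measurable]: "\<phi> \<in> borel_measurable (lebesgue_on \<Omega>)" "f \<in> borel_measurable (lebesgue_on \<Omega>)"
    "u \<in> borel_measurable (lebesgue_on \<Omega>)" "A u \<in> borel_measurable (lebesgue_on \<Omega>)"
    using assms by (auto simp: L2_def L2_operator_def)
  have "{x \<in> space (lebesgue_on \<Omega>). u x = \<phi> x \<and> A u x - f x > 0} \<in> sets (lebesgue_on \<Omega>)"
    and "{x \<in> space (lebesgue_on \<Omega>). u x > \<phi> x \<or> A u x - f x \<le> 0} \<in> sets (lebesgue_on \<Omega>)"
    by measurable
  then show "bm_active \<Omega> A f \<phi> u \<in> sets (lebesgue_on \<Omega>)"
    and "bm_inactive \<Omega> A f \<phi> u \<in> sets (lebesgue_on \<Omega>)"
    unfolding bm_active_def bm_inactive_def obj_grad_def by auto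
qed

text \<open>The first iterate is feasible by assumption, every later one as a projection. Membership
  of the iterates in \<open>L2\<close> is obtained from this.\<close>

lemma bm_iterates_feasible:
  assumes "bm_iterates \<Omega> A f \<phi> u du"
  shows "u k \<in> feasible \<Omega> \<phi>"
  using assms by (cases k) (auto simp: bm_iterates_def is_L2_projection_def Let_def)

theorem theoremA1:
  fixes \<Omega> :: "'a::euclidean_space set"
    and A :: "('a \<Rightarrow> real) \<Rightarrow> ('a \<Rightarrow> real)"
    and f \<phi> :: "'a \<Rightarrow> real"
    and y l yh u du :: "nat \<Rightarrow> 'a \<Rightarrow> real"
    and k :: nat
  assumes "open \<Omega>" and "connected \<Omega>" and "\<Omega> \<noteq> {}"
    and "f \<in> L2 \<Omega>" and "\<phi> \<in> L2 \<Omega>"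
    and "L2_operator \<Omega> A" and "L2_self_adjoint \<Omega> A" and "L2_coercive \<Omega> A"
    and "hik_iterates \<Omega> A f \<phi> y l"
    and "hik_half_steps \<Omega> \<phi> y l yh"
    and "bm_iterates \<Omega> A f \<phi> u du"
    and "ae_set_eq \<Omega> (bm_active \<Omega> A f \<phi> (u k)) (hik_active \<Omega> \<phi> (y k) (l k))"
    and "ae_set_eq \<Omega> (bm_inactive \<Omega> A f \<phi> (u k)) (hik_inactive \<Omega> \<phi> (y k) (l k))"
    and "ae_eq (hik_inactive \<Omega> \<phi> (y k) (l k))
           (restrict (y k) (hik_inactive \<Omega> \<phi> (y k) (l k)))
           (restrict (u k) (bm_inactive \<Omega> A f \<phi> (u k)))"
  shows "ae_eq \<Omega> (yh k) (u k) \<and>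
         ae_eq (hik_inactive \<Omega> \<phi> (y k) (l k))
           (restrict (\<lambda>x. y (Suc k) x - y k x) (hik_inactive \<Omega> \<phi> (y k) (l k)))
           (restrict (du k) (bm_inactive \<Omega> A f \<phi> (u k))) \<and>
         ae_eq \<Omega> (yh (Suc k)) (u (Suc k))"
proof -
  let ?HA = "\<lambda>j. hik_active \<Omega> \<phi> (y j) (l j)" and ?HI = "\<lambda>j. hik_inactive \<Omega> \<phi> (y j) (l j)"
  let ?BA = "bm_active \<Omega> A f \<phi> (u k)" and ?BI = "bm_inactive \<Omega> A f \<phi> (u k)"
  let ?d = "ext0 ?BI (restrict (du k) ?BI)"
  note f = assms(4) and \<phi> = assms(5) and A = assms(6)
  note hik = assms(9) and half = assms(10) and bm = assms(11)
  have \<Omega>: "\<Omega> \<in> sets lebesgue"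
    using assms(1) by (simp add: borel_open)
  have y: "y j \<in> L2 \<Omega>" and l: "l j \<in> L2 \<Omega>" for j
    using hik by (auto simp: hik_iterates_def)
  have u: "u j \<in> L2 \<Omega>" for j
    using bm_iterates_feasible[OF bm] by (auto simp: feasible_def)
  have du: "du j \<in> L2 \<Omega>" for j
    using bm by (simp add: bm_iterates_def)
  note HAI = hik_active_sets[OF \<phi> y l] and BAI = bm_active_sets[OF \<phi> f u A]
  note on_HA = ae_eq_subset_iff[OF \<Omega> HAI(1)] and on_HI = ae_eq_subset_iff[OF \<Omega> HAI(2)]
  note on_BA = ae_eq_subset_iff[OF \<Omega> BAI(1)] and on_BI = ae_eq_subset_iff[OF \<Omega> BAI(2)]

  have state: "AE x in lebesgue_on \<Omega>. A (y (Suc j)) x - l (Suc j) x = f x" for j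
    using hik by (simp add: hik_iterates_def Let_def ae_eq_def)
  \<comment> \<open>The HIK facts are stated for all \<open>j\<close> since the last equality uses
    them at \<open>k\<close> and at \<open>Suc k\<close>. The congruence rule makes the premise
    \<open>x \<in> ?HA j\<close> available for evaluating \<open>restrict\<close>.\<close>
  have y_act: "AE x in lebesgue_on \<Omega>. x \<in> ?HA j \<longrightarrow> y (Suc j) x = \<phi> x" for j
    using hik unfolding hik_iterates_def Let_def on_HA by (auto cong: imp_cong)
  have l_ina: "AE x in lebesgue_on \<Omega>. x \<in> ?HI j \<longrightarrow> l (Suc j) x = 0" for j
    using hik unfolding hik_iterates_def Let_def on_HI by (auto cong: imp_cong)
  have yh_act: "AE x in lebesgue_on \<Omega>. x \<in> ?HA j \<longrightarrow> yh j x = y (Suc j) x" for j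
    using half unfolding hik_half_steps_def Let_def on_HA by (auto cong: imp_cong)
  have yh_ina: "AE x in lebesgue_on \<Omega>. x \<in> ?HI j \<longrightarrow> yh j x = y j x" for j
    using half unfolding hik_half_steps_def Let_def on_HI by (auto cong: imp_cong)
  have du_ina: "AE x in lebesgue_on \<Omega>. x \<in> ?BI \<longrightarrow> A ?d x = - (A (u k) x - f x)"
    using bm unfolding bm_iterates_def Let_def on_BI by (auto simp: obj_grad_def cong: imp_cong)
  have du_act: "AE x in lebesgue_on \<Omega>. x \<in> ?BA \<longrightarrow> du k x = 0"
    using bm unfolding bm_iterates_def Let_def on_BA by (auto cong: imp_cong)
  have proj: "is_L2_projection \<Omega> (feasible \<Omega> \<phi>) (\<lambda>x. u k x + du k x) (u (Suc k))"
    using bm by (simp add: bm_iterates_def Let_def)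

  have same_act: "AE x in lebesgue_on \<Omega>. x \<in> ?BA \<longleftrightarrow> x \<in> ?HA k"
    and same_ina: "AE x in lebesgue_on \<Omega>. x \<in> ?BI \<longleftrightarrow> x \<in> ?HI k"
    using assms(12,13) by (simp_all add: ae_set_eq_def)
  have "AE x in lebesgue_on \<Omega>. x \<in> ?HI k \<longrightarrow> restrict (y k) (?HI k) x = restrict (u k) ?BI x"
    using assms(14) unfolding on_HI .
  \<comment> \<open>The right-hand \<open>restrict\<close> is meaningful only on \<open>?BI\<close>,
    which agrees with \<open>?HI k\<close> up to a null set.\<close>
  then have yu_ina: "AE x in lebesgue_on \<Omega>. x \<in> ?HI k \<longrightarrow> y k x = u k x"
    using same_ina by eventually_elim auto
  have split: "AE x in lebesgue_on \<Omega>. x \<in> ?HA j \<longleftrightarrow> x \<notin> ?HI j" for j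
    by (rule AE_I2) (auto simp: hik_active_def hik_inactive_def)
  have u_act: "x \<in> ?BA \<Longrightarrow> u k x = \<phi> x" for x
    by (simp add: bm_active_def)

  \<comment> \<open>On the active set both sides are \<phi>; on the inactive set both are
    \<open>y k\<close>.\<close>
  have half_eq: "AE x in lebesgue_on \<Omega>. yh k x = u k x"
    using split[of k] yh_act[of k] y_act[of k] yh_ina[of k] yu_ina same_act
    by eventually_elim (use u_act in auto)

  \<comment> \<open>The gap between the HIK iterate and the unprojected BM step, formed with
    \<open>?d\<close> because the BM equation applies \<open>A\<close> to that truncation of
    \<open>du k\<close>.\<close>
  define e where "e = (\<lambda>x. y (Suc k) x - (u k x + ?d x))"
  have "?d = ext0 ?BI (du k)"
    by (auto simp: ext0_def)
  then have d: "?d \<in> L2 \<Omega>"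
    using L2_ext0[OF du BAI(2)] by simp
  have e: "e \<in> L2 \<Omega>"
    unfolding e_def by (intro L2_diff L2_add y u d)
  have add: "AE x in lebesgue_on \<Omega>. A (\<lambda>x. u k x + ?d x) x = A (u k) x + A ?d x"
    using A u d by (simp add: L2_operator_def ae_eq_def)
  have "AE x in lebesgue_on \<Omega>. A e x = A (y (Suc k)) x - A (\<lambda>x. u k x + ?d x) x"
    using L2_operator_diff[OF A y L2_add[OF u d]] unfolding e_def ae_eq_def .
  with add have Ae: "AE x in lebesgue_on \<Omega>. A e x = A (y (Suc k)) x - (A (u k) x + A ?d x)"
    by eventually_elim simp
  \<comment> \<open>Active points: \<open>y (Suc k)\<close> and \<open>u k\<close> are both \<phi>,
    and \<open>?d\<close> is 0. Inactive points: the multiplier \<open>l (Suc k)\<close> is 0, so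
    \<open>A (y (Suc k))\<close> is \<open>f\<close>, and the BM equation makes
    \<open>A (u k) + A ?d\<close> equal to \<open>f\<close> as well.\<close>
  have "AE x in lebesgue_on \<Omega>. e x = 0 \<or> A e x = 0"
    using Ae split[of k] same_act same_ina y_act[of k] state[of k] l_ina[of k] du_ina
    by eventually_elim (use u_act in \<open>auto simp: e_def ext0_def\<close>)
  then have "AE x in lebesgue_on \<Omega>. e x = 0"
    using coercive_eq_0I[OF assms(8) e] by (simp add: ae_eq_def)
  \<comment> \<open>\<open>?d\<close> may be replaced by \<open>du k\<close>, which is null on the
    BM active set.\<close>
  then have step: "AE x in lebesgue_on \<Omega>. y (Suc k) x = u k x + du k x"
    using split[of k] same_act same_ina du_act
    by eventually_elim (auto simp: e_def ext0_def split: if_splits)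

  have "AE x in lebesgue_on \<Omega>. x \<in> ?HI k \<longrightarrow>
      restrict (\<lambda>x. y (Suc k) x - y k x) (?HI k) x = restrict (du k) ?BI x"
    using step yu_ina same_ina by eventually_elim auto
  then have update_eq: "ae_eq (?HI k) (restrict (\<lambda>x. y (Suc k) x - y k x) (?HI k)) (restrict (du k) ?BI)"
    unfolding on_HI .

  have "AE x in lebesgue_on \<Omega>. u (Suc k) x = max (u k x + du k x) (\<phi> x)"
    using L2_projection_feasible_eq_max[OF L2_add[OF u du] \<phi> proj] by (simp add: ae_eq_def)
  moreover have "AE x in lebesgue_on \<Omega>. yh (Suc k) x = max (y (Suc k) x) (\<phi> x)"
    using AE_space split[of k] y_act[of k] l_ina[of k] split[of "Suc k"]
      y_act[of "Suc k"] yh_act[of "Suc k"] yh_ina[of "Suc k"]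
  proof eventually_elim
    case (elim x)
    \<comment> \<open>If \<open>y (Suc k) x\<close> is \<phi>, the half step is \<phi> on either set
      of iteration \<open>Suc k\<close>. If the multiplier is 0, the point is active exactly when
      \<open>y (Suc k) x\<close> lies below \<phi>, and there the half step lifts it to
      \<phi>.\<close>
    have "y (Suc k) x = \<phi> x \<or> l (Suc k) x = 0"
      using elim by blast
    then show ?case
      using elim by (auto simp: hik_active_def hik_inactive_def max_def)
  qed
  ultimately have "AE x in lebesgue_on \<Omega>. yh (Suc k) x = u (Suc k) x"
    using step by eventually_elim simp
  with half_eq update_eq show ?thesis
    by (simp add: ae_eq_def)
qed

end
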